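(* Let $m_0 = 7\cdot 11\cdot 13\cdot 17\cdot 19\cdot 29\cdot 71\cdot 83 = 55254930731$ and let $$G_0 = A_5\times C_2\times C_7\times C_{11}\times C_{13}\times C_{17}\times C_{19}\times C_{29}\times C_{71}\times C_{83}.$$ Then $G_0$ is nonsolvable, $G_0\not\cong A_5$, and $\gamma(G_0)=\frac92$. Consequently, the assertion "for every finite nonsolvable group $G$, $\gamma(G)=\frac92$ if and only if $G\cong A_5$" is false.
   Context: $C_n$ denotes the cyclic group of order $n$ and $A_5$ the alternating group of degree $5$. For a finite group $G$, $\pi(G)$ is the set of primes dividing $|G|$; for $p\in\pi(G)$, $\nu_p(G)$ is the number of Sylow $p$-subgroups of $G$ and $\sigma_p(G)$ is their common order. The Sylow-integral invariant is $$\gamma(G)=\int_0^1\sum_{p\in\pi(G)}\nu_p(G)x^{\sigma_p(G)}\,dx=\sum_{p\in\pi(G)}\frac{\nu_p(G)}{\sigma_p(G)+1}.$$ *)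

theory Defs
  imports
    "HOL-Analysis.Analysis"
    "HOL-Algebra.Elementary_Groups"
    "HOL-Algebra.Solvable_Groups"
    "HOL-Algebra.Sym_Groups"
begin

definition sylow_order :: "('a, 'b) monoid_scheme \<Rightarrow> nat \<Rightarrow> nat" where
  "sylow_order G p = p ^ multiplicity p (Coset.order G)"

definition sylow_subgroups :: "('a, 'b) monoid_scheme \<Rightarrow> nat \<Rightarrow> 'a set set" where
  "sylow_subgroups G p = {H. subgroup H G \<and> card H = sylow_order G p}"

text \<open>
  Meaningful for finite groups only: for infinite \<open>G\<close>, \<^term>\<open>Coset.order G\<close> is \<open>0\<close>,
  so the index set is empty.
\<close>

definition sylow_gamma :: "('a, 'b) monoid_scheme \<Rightarrow> real" where
  "sylow_gamma G =
     integral {0..1} (\<lambda>x::real. \<Sum>p\<in>prime_factors (Coset.order G).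
       real (card (sylow_subgroups G p)) * x ^ sylow_order G p)"

lemma sylow_gamma_eq_sum:
  "sylow_gamma G =
     (\<Sum>p\<in>prime_factors (Coset.order G).
       real (card (sylow_subgroups G p)) / real (sylow_order G p + 1))"
proof -
  have power: "((\<lambda>x::real. x ^ n) has_integral 1 / real (n + 1)) {0..1}" for n
  proof -
    have "((\<lambda>x::real. x ^ n) has_integral 1 ^ Suc n / real (Suc n) - 0 ^ Suc n / real (Suc n)) {0..1}"
      by (rule fundamental_theorem_of_calculus)
         (auto intro!: derivative_eq_intros simp flip: has_real_derivative_iff_has_vector_derivative
               simp del: of_nat_Suc power_Suc)
    then show ?thesis by simp
  qed
  have "((\<lambda>x::real. \<Sum>p\<in>prime_factors (Coset.order G).
       real (card (sylow_subgroups G p)) * x ^ sylow_order G p) has_integral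
     (\<Sum>p\<in>prime_factors (Coset.order G).
       real (card (sylow_subgroups G p)) * (1 / real (sylow_order G p + 1)))) {0..1}"
    by (intro has_integral_sum has_integral_mult_right power) simp
  then show ?thesis
    unfolding sylow_gamma_def by (simp add: integral_unique)
qed

abbreviation A5 :: "(nat \<Rightarrow> nat) monoid" where
  "A5 \<equiv> alt_group 5"

abbreviation C :: "nat \<Rightarrow> int monoid" where
  "C n \<equiv> integer_mod_group n"

definition m0 :: nat where
  "m0 = 7 * 11 * 13 * 17 * 19 * 29 * 71 * 83"

definition G0 where
  "G0 = A5 \<times>\<times> C 2 \<times>\<times> C 7 \<times>\<times> C 11 \<times>\<times> C 13 \<times>\<times> C 17 \<times>\<times> C 19 \<times>\<times> C 29 \<times>\<times> C 71 \<times>\<times> C 83"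

lemma group_G0: "group G0"
  unfolding G0_def by (intro DirProd_group group_integer_mod_group alt_group_is_group)

lemma finite_G0: "finite (carrier G0)"
proof -
  have "finite (carrier A5)"
    by (rule finite_subset[OF _ finite_permutations[of "{1..5}"]])
       (auto simp: alt_group_def)
  then show ?thesis
    by (simp add: G0_def carrier_integer_mod_group)
qed

text \<open>
  Statements about all finite groups can be made over the type \<^typ>\<open>nat monoid\<close>:
  every finite group is isomorphic to one whose carrier is a subset of \<^typ>\<open>nat\<close>.
\<close>

end

theory Submission
  imports Defs "HOL-Algebra.Weak_Morphisms"
begin

text \<open>
  The group \<open>A\<^sub>5\<close> has \<open>5\<close>, \<open>10\<close> and \<open>6\<close> Sylow subgroups, of orders \<open>4\<close>, \<open>3\<close> and \<open>5\<close>, so its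
  invariant is \<open>5/5 + 10/4 + 6/6 = 9/2\<close>.  A Sylow \<open>p\<close>-subgroup of a direct product of finite
  groups is the product of its two projections, so the number of Sylow \<open>p\<close>-subgroups and their
  common order are both multiplicative (\<open>card_sylow_subgroups_DirProd\<close>,
  \<open>sylow_order_DirProd\<close>).  A cyclic factor of prime order \<open>q\<close> therefore changes no Sylow number and
  multiplies the Sylow order at \<open>q\<close> by \<open>q\<close>.  The factor \<open>C\<^sub>2\<close> lowers the term at \<open>2\<close> from \<open>5/5\<close>
  to \<open>5/9\<close>, a loss of \<open>4/9\<close>; every further prime \<open>q\<close> adds the new term \<open>1/(q + 1)\<close>, and
  \<open>1/8 + 1/12 + 1/14 + 1/18 + 1/20 + 1/30 + 1/72 + 1/84 = 4/9\<close> restores the balance.  The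
  product is nonsolvable because it contains \<open>A\<^sub>5\<close>, and it is too large to be isomorphic to
  \<open>A\<^sub>5\<close>.

  The Sylow numbers of \<open>A\<^sub>5\<close> come from its centralizers.  Every group of order at most \<open>5\<close> is
  abelian, so a Sylow subgroup lies in the centralizer of each of its elements and its order divides
  the order of that centralizer; but in \<open>A\<^sub>5\<close> the centralizer of a nonidentity element has order
  \<open>3\<close>, \<open>4\<close> or \<open>5\<close>, so the two coincide.  Hence the
  Sylow subgroups of order \<open>s\<close> partition the nonidentity elements whose centralizer has order \<open>s\<close>
  into blocks of size \<open>s - 1\<close> (\<open>card_subgroups_eq_centralizers\<close>).  The centralizer orders are
  computed from an explicit list of the 60 even permutations (\<open>centralizer_orders\<close>):
  \<open>20\<close> elements have centralizer order \<open>3\<close>, \<open>15\<close> have \<open>4\<close> and \<open>24\<close> have \<open>5\<close>.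
\<close>

section \<open>Subgroups that are centralizers\<close>

text \<open>
  If \<open>x\<close> and \<open>y\<close> do not commute, then \<open>1, x, y, xy, yx\<close> are five distinct elements and exhaust the
  subgroup.  Locating the products \<open>x\<^sup>2\<close> and \<open>xyx\<close> among them leaves only \<open>x\<^sup>2 = 1\<close> and
  \<open>xyx = y\<close>, which together make \<open>x\<close> and \<open>y\<close> commute.
\<close>
lemma (in group) subgroup_card_le_5_comm:
  assumes P: "subgroup P G" "finite P" "card P \<le> 5" and x: "x \<in> P" and y: "y \<in> P"
  shows "x \<otimes> y = y \<otimes> x"
proof (rule ccontr)
  assume ne: "x \<otimes> y \<noteq> y \<otimes> x"
  have [simp]: "x \<in> carrier G" "y \<in> carrier G"
    using subgroup.mem_carrier[OF P(1)] x y by auto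
  let ?S = "{\<one>, x, y, x \<otimes> y, y \<otimes> x}"
  have "x \<noteq> \<one>" "y \<noteq> \<one>" "x \<noteq> y" using ne by auto
  moreover have "x \<otimes> y \<noteq> \<one>" "y \<otimes> x \<noteq> \<one>"
    using ne by (metis inv_comm \<open>x \<in> carrier G\<close> \<open>y \<in> carrier G\<close>)+
  ultimately have "card ?S = 5"
    using ne by (auto simp: card_insert_if)
  moreover have "?S \<subseteq> P"
    using P(1) x y by (auto intro: subgroup.one_closed subgroup.m_closed)
  ultimately have P_eq: "P = ?S"
    using P(2,3) by (metis card_mono card_subset_eq le_antisym)
  have "x \<otimes> x \<in> ?S"
    using subgroup.m_closed[OF P(1) x x] P_eq by simp
  moreover have "x \<otimes> x \<noteq> y"
    using ne by (auto simp: m_assoc)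
  ultimately have xx: "x \<otimes> x = \<one>"
    using ne \<open>x \<noteq> \<one>\<close> \<open>x \<noteq> y\<close> by auto
  have "(x \<otimes> y) \<otimes> x \<in> ?S"
    using subgroup.m_closed[OF P(1) subgroup.m_closed[OF P(1) x y] x] P_eq by simp
  moreover have "(x \<otimes> y) \<otimes> x \<noteq> x"
    using \<open>x \<otimes> y \<noteq> \<one>\<close> by simp
  moreover have "(x \<otimes> y) \<otimes> x \<noteq> x \<otimes> y" "(x \<otimes> y) \<otimes> x \<noteq> y \<otimes> x"
    using \<open>x \<noteq> \<one>\<close> by (simp_all add: m_assoc)
  moreover have "(x \<otimes> y) \<otimes> x \<noteq> \<one>"
  proof
    assume "(x \<otimes> y) \<otimes> x = \<one>"
    then have "(x \<otimes> y) \<otimes> x = x \<otimes> x" using xx by simp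
    then show False using \<open>y \<noteq> \<one>\<close> by simp
  qed
  ultimately have "(x \<otimes> y) \<otimes> x = y" by blast
  then have "y \<otimes> x = x \<otimes> y \<otimes> (x \<otimes> x)" by (metis \<open>x \<in> carrier G\<close> \<open>y \<in> carrier G\<close> m_assoc m_closed)
  then show False using ne xx by simp
qed

definition centralizer :: "('a, 'b) monoid_scheme \<Rightarrow> 'a \<Rightarrow> 'a set" where
  "centralizer G x = {y \<in> carrier G. x \<otimes>\<^bsub>G\<^esub> y = y \<otimes>\<^bsub>G\<^esub> x}"

lemma (in group) centralizer_subgroup:
  assumes [simp]: "x \<in> carrier G"
  shows "subgroup (centralizer G x) G"
proof (rule subgroupI)
  show "centralizer G x \<subseteq> carrier G" "centralizer G x \<noteq> {}"
    unfolding centralizer_def by auto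
  show "a \<otimes> b \<in> centralizer G x" if "a \<in> centralizer G x" "b \<in> centralizer G x" for a b
  proof -
    from that have [simp]: "a \<in> carrier G" "b \<in> carrier G"
      and ab: "x \<otimes> a = a \<otimes> x" "x \<otimes> b = b \<otimes> x"
      by (auto simp: centralizer_def)
    have "x \<otimes> (a \<otimes> b) = a \<otimes> (x \<otimes> b)"
      by (simp add: ab(1) flip: m_assoc)
    then show ?thesis by (simp add: centralizer_def ab(2) m_assoc)
  qed
  show "inv a \<in> centralizer G x" if "a \<in> centralizer G x" for a
  proof -
    from that have [simp]: "a \<in> carrier G" and a: "x \<otimes> a = a \<otimes> x"
      by (auto simp: centralizer_def)
    have "x \<otimes> inv a = inv a \<otimes> (a \<otimes> x) \<otimes> inv a"
      by (simp flip: m_assoc)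
    also have "\<dots> = inv a \<otimes> x"
      by (simp add: m_assoc flip: a)
    finally show ?thesis by (simp add: centralizer_def)
  qed
qed

lemma (in group) subgroup_card_dvd:
  assumes "subgroup H G" "subgroup K G" "H \<subseteq> K"
  shows "card H dvd card K"
proof -
  interpret K: group "G\<lparr>carrier := K\<rparr>" using assms(2) by (rule subgroup_imp_group)
  have "subgroup H (G\<lparr>carrier := K\<rparr>)" using assms by (intro subgroup_incl)
  from K.lagrange[OF this] show ?thesis by (simp add: order_def dvd_def) (metis mult.commute)
qed

text \<open>
  A subgroup of order \<open>s\<close>, being abelian, is contained in the centralizer of each of its nonidentity
  elements, and equal to it by the hypothesis on centralizer orders.  So the subgroups of order
  \<open>s\<close> meet pairwise only in the identity, and the elements counted on the right are exactly their
  nonidentity elements.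
\<close>
lemma (in group) card_subgroups_eq_centralizers:
  assumes fin: "finite (carrier G)"
    and comm: "\<And>P x y. subgroup P G \<Longrightarrow> card P = s \<Longrightarrow> x \<in> P \<Longrightarrow> y \<in> P \<Longrightarrow> x \<otimes> y = y \<otimes> x"
    and cent: "\<And>x. x \<in> carrier G - {\<one>} \<Longrightarrow> s dvd card (centralizer G x) \<Longrightarrow> card (centralizer G x) = s"
  shows "card {P. subgroup P G \<and> card P = s} * (s - 1) =
         card {x \<in> carrier G - {\<one>}. card (centralizer G x) = s}"
    (is "card ?F * _ = card ?T")
proof -
  have finP: "finite P" if "subgroup P G" for P
    using that fin finite_subset subgroup.subset by blast
  have key: "card (centralizer G x) = s" "centralizer G x = P" if "P \<in> ?F" "x \<in> P - {\<one>}" for P x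
  proof -
    have P: "subgroup P G" "card P = s" and x: "x \<in> carrier G" "x \<noteq> \<one>"
      using that subgroup.mem_carrier by auto
    have sub: "P \<subseteq> centralizer G x"
      using comm[OF P] that subgroup.mem_carrier[OF P(1)] unfolding centralizer_def by auto
    then have "s dvd card (centralizer G x)"
      using subgroup_card_dvd[OF P(1) centralizer_subgroup[OF x(1)]] P(2) by simp
    then show c: "card (centralizer G x) = s" using cent x by auto
    show "centralizer G x = P"
      using card_subset_eq[OF finP[OF centralizer_subgroup[OF x(1)]] sub] c P(2) by simp
  qed
  have T: "?T = (\<Union>P\<in>?F. P - {\<one>})"
  proof (intro equalityI subsetI)
    fix x assume x: "x \<in> ?T"
    then have "x \<in> centralizer G x" "centralizer G x \<in> ?F"
      using centralizer_subgroup by (auto simp: centralizer_def)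
    then show "x \<in> (\<Union>P\<in>?F. P - {\<one>})" using x by blast
  next
    fix x assume "x \<in> (\<Union>P\<in>?F. P - {\<one>})"
    then obtain P where "P \<in> ?F" "x \<in> P - {\<one>}" by blast
    then show "x \<in> ?T" using key(1) subgroup.mem_carrier by fastforce
  qed
  have "?F \<subseteq> Pow (carrier G)" using subgroup.subset by blast
  then have "finite ?F" using fin finite_subset by blast
  moreover have "(P - {\<one>}) \<inter> (Q - {\<one>}) = {}" if "P \<in> ?F" "Q \<in> ?F" "P \<noteq> Q" for P Q
    using that key(2)[of P] key(2)[of Q] by blast
  ultimately have "card ?T = (\<Sum>P\<in>?F. card (P - {\<one>}))"
    unfolding T using finP by (intro card_UN_disjoint) simp_all
  also have "\<dots> = (\<Sum>P\<in>?F. s - 1)"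
    by (intro sum.cong) (auto simp: subgroup.one_closed)
  finally show ?thesis by simp
qed

section \<open>Sylow subgroups of direct products, cyclic groups and isomorphic copies\<close>

lemma (in group_hom) card_img_dvd:
  "card (h ` carrier G) dvd card (carrier G)"
proof -
  let ?I = "H\<lparr>carrier := h ` carrier G\<rparr>"
  have "group ?I" using img_is_subgroup H.subgroup_imp_group by blast
  then interpret I: group_hom G ?I h
    by (simp add: group_hom_def group_hom_axioms_def hom_def)
  have "G Mod (kernel G ?I h) \<cong> ?I" by (rule I.FactGroup_iso) simp
  then have "card (rcosets (kernel G ?I h)) = card (h ` carrier G)"
    using iso_same_card by (fastforce simp: FactGroup_def)
  then show ?thesis
    using G.lagrange[OF I.subgroup_kernel] dvd_triv_left[of "card (h ` carrier G)"]
    by (metis order_def)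
qed

lemma order_DirProd: "order (G \<times>\<times> H) = order G * order H"
  by (simp add: order_def DirProd_def card_cartesian_product)

lemma sylow_order_DirProd:
  assumes "prime p" "order G \<noteq> 0" "order H \<noteq> 0"
  shows "sylow_order (G \<times>\<times> H) p = sylow_order G p * sylow_order H p"
  using assms by (simp add: sylow_order_def order_DirProd power_add
      prime_elem_multiplicity_mult_distrib)

lemma card_p_subgroup_le_sylow_order:
  assumes "group G" "finite (carrier G)" "prime p" "subgroup P G" "card P dvd p ^ k"
  shows "card P \<le> sylow_order G p"
proof -
  obtain i where i: "card P = p ^ i"
    using assms(3,5) divides_primepow_nat by blast
  have "p ^ i dvd order G" using group.lagrange[OF assms(1,4)] i by (metis dvd_triv_right)
  moreover have "order G \<noteq> 0"
    using assms(1,2) by (metis group.is_monoid monoid.order_gt_0_iff_finite less_not_refl)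
  ultimately have "i \<le> multiplicity p (order G)"
    using assms(3) by (intro multiplicity_geI) (auto simp: prime_nat_iff)
  then show ?thesis
    using i power_increasing[OF _ prime_ge_1_nat[OF assms(3)]] by (simp add: sylow_order_def)
qed

text \<open>
  The projections \<open>P\<close>, \<open>Q\<close> of a Sylow subgroup \<open>R\<close> of the product are \<open>p\<close>-groups, so neither is larger
  than a Sylow subgroup of its factor.  As \<open>R \<subseteq> P \<times> Q\<close> and the order of \<open>R\<close> is the product of the two
  bounds, both bounds are attained and \<open>R = P \<times> Q\<close>.
\<close>
lemma sylow_subgroups_DirProd:
  assumes G: "group G" "finite (carrier G)" and H: "group H" "finite (carrier H)" and p: "prime p"
  shows "sylow_subgroups (G \<times>\<times> H) p =
         (\<lambda>(P, Q). P \<times> Q) ` (sylow_subgroups G p \<times> sylow_subgroups H p)"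
proof -
  interpret G: group G by fact
  interpret H: group H by fact
  interpret GH: group "G \<times>\<times> H" using G(1) H(1) by (rule DirProd_group)
  have ord: "order G \<noteq> 0" "order H \<noteq> 0"
    using G(2) H(2) G.order_gt_0_iff_finite H.order_gt_0_iff_finite by auto
  have so: "sylow_order (G \<times>\<times> H) p = sylow_order G p * sylow_order H p"
    using p ord by (rule sylow_order_DirProd)
  show ?thesis
  proof (intro equalityI subsetI)
    fix R assume "R \<in> sylow_subgroups (G \<times>\<times> H) p"
    then have R: "subgroup R (G \<times>\<times> H)" "card R = sylow_order (G \<times>\<times> H) p"
      by (auto simp: sylow_subgroups_def)
    interpret R: group "(G \<times>\<times> H)\<lparr>carrier := R\<rparr>"
      using R(1) by (rule GH.subgroup_imp_group)
    have Rsub: "R \<subseteq> carrier G \<times> carrier H"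
      using subgroup.subset[OF R(1)] by simp
    interpret f: group_hom "(G \<times>\<times> H)\<lparr>carrier := R\<rparr>" G fst
      using Rsub by unfold_locales (auto simp: hom_def DirProd_def)
    interpret s: group_hom "(G \<times>\<times> H)\<lparr>carrier := R\<rparr>" H snd
      using Rsub by unfold_locales (auto simp: hom_def DirProd_def)
    let ?P = "fst ` R" and ?Q = "snd ` R"
    have P: "subgroup ?P G" and Q: "subgroup ?Q H"
      using f.img_is_subgroup s.img_is_subgroup by auto
    have finPQ: "finite ?P" "finite ?Q"
      using P Q G(2) H(2) subgroup.subset finite_subset by metis+
    have "card ?P dvd card R" "card ?Q dvd card R"
      using f.card_img_dvd s.card_img_dvd by auto
    then have le: "card ?P \<le> sylow_order G p" "card ?Q \<le> sylow_order H p"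
      using card_p_subgroup_le_sylow_order G H p P Q R(2) unfolding sylow_order_def by metis+
    have "R \<subseteq> ?P \<times> ?Q" by force
    have "sylow_order G p * sylow_order H p \<le> card ?P * card ?Q"
      using card_mono[OF _ \<open>R \<subseteq> ?P \<times> ?Q\<close>] finPQ R(2) so by (simp add: card_cartesian_product)
    moreover have "card ?P * card ?Q \<le> card ?P * sylow_order H p"
      "card ?P * card ?Q \<le> sylow_order G p * card ?Q"
      using le by (intro mult_le_mono; simp)+
    ultimately have "sylow_order G p * sylow_order H p \<le> card ?P * sylow_order H p"
      "sylow_order G p * sylow_order H p \<le> sylow_order G p * card ?Q"
      by linarith+
    moreover have "sylow_order G p > 0" "sylow_order H p > 0"
      using p by (auto simp: sylow_order_def prime_gt_0_nat)
    ultimately have eq: "card ?P = sylow_order G p" "card ?Q = sylow_order H p"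
      using le by simp_all
    have "R = ?P \<times> ?Q"
      using card_subset_eq[OF _ \<open>R \<subseteq> ?P \<times> ?Q\<close>] finPQ R(2) so eq by (simp add: card_cartesian_product)
    then show "R \<in> (\<lambda>(P, Q). P \<times> Q) ` (sylow_subgroups G p \<times> sylow_subgroups H p)"
      using P Q eq by (auto simp: sylow_subgroups_def intro!: image_eqI[of _ _ "(?P, ?Q)"])
  next
    fix R assume "R \<in> (\<lambda>(P, Q). P \<times> Q) ` (sylow_subgroups G p \<times> sylow_subgroups H p)"
    then show "R \<in> sylow_subgroups (G \<times>\<times> H) p"
      using DirProd_subgroups[OF G(1) _ H(1)]
      by (auto simp: sylow_subgroups_def so card_cartesian_product)
  qed
qed

lemma card_sylow_subgroups_DirProd:
  assumes "group G" "finite (carrier G)" "group H" "finite (carrier H)" "prime p"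
  shows "card (sylow_subgroups (G \<times>\<times> H) p) = card (sylow_subgroups G p) * card (sylow_subgroups H p)"
proof -
  have "inj_on (\<lambda>(P, Q). P \<times> Q) (sylow_subgroups G p \<times> sylow_subgroups H p)"
    by (rule inj_onI) (auto simp: sylow_subgroups_def times_eq_iff dest: subgroup.one_closed)
  then show ?thesis
    by (simp add: sylow_subgroups_DirProd[OF assms] card_image card_cartesian_product)
qed

lemma sylow_order_not_dvd: "\<not> p dvd order G \<Longrightarrow> sylow_order G p = 1"
  by (simp add: sylow_order_def not_dvd_imp_multiplicity_0)

lemma (in group) card_sylow_subgroups_not_dvd:
  assumes "\<not> p dvd order G"
  shows "card (sylow_subgroups G p) = 1"
proof -
  have "sylow_subgroups G p = {{\<one>}}"
    using assms triv_subgroup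
    by (auto simp: sylow_subgroups_def sylow_order_not_dvd card_1_singleton_iff dest: subgroup.one_closed)
  then show ?thesis by simp
qed

lemma order_C: "n > 0 \<Longrightarrow> order (C n) = n"
  by (simp add: order_def carrier_integer_mod_group)

lemma finite_carrier_C: "n > 0 \<Longrightarrow> finite (carrier (C n))"
  by (simp add: carrier_integer_mod_group)

lemma sylow_order_C_prime:
  "prime p \<Longrightarrow> prime q \<Longrightarrow> sylow_order (C q) p = (if p = q then q else 1)"
  by (auto simp: sylow_order_def order_C prime_gt_0_nat prime_multiplicity_other not_prime_0)

lemma card_sylow_subgroups_C_prime:
  assumes p: "prime p" and q: "prime q"
  shows "card (sylow_subgroups (C q) p) = 1"
proof (cases "p = q")
  case True
  have "H = carrier (C q)" if "subgroup H (C q)" "card H = q" for H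
    using card_subset_eq[OF finite_carrier_C subgroup.subset[OF that(1)]] that(2) order_C[of q] q
    by (simp add: order_def prime_gt_0_nat)
  moreover have "carrier (C q) \<in> sylow_subgroups (C q) p"
    using q True sylow_order_C_prime[OF p q] order_C[of q] group.subgroup_self[OF group_integer_mod_group]
    by (auto simp: sylow_subgroups_def order_def prime_gt_0_nat)
  ultimately have "sylow_subgroups (C q) p = {carrier (C q)}"
    using sylow_order_C_prime[OF p q] True by (auto simp: sylow_subgroups_def)
  then show ?thesis by simp
next
  case False
  then show ?thesis
    using p q group.card_sylow_subgroups_not_dvd[OF group_integer_mod_group, of p q]
    by (simp add: order_C prime_gt_0_nat primes_dvd_imp_eq) (metis primes_dvd_imp_eq)
qed

lemma sylow_subgroups_iso_image:
  assumes "group G" "group H" "f \<in> iso G H" "P \<in> sylow_subgroups G p"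
  shows "f ` P \<in> sylow_subgroups H p"
proof -
  interpret group_hom G H f using assms by (simp add: group_hom_def group_hom_axioms_def iso_def)
  have P: "subgroup P G" "card P = sylow_order G p" using assms(4) by (auto simp: sylow_subgroups_def)
  have "order G = order H"
    using assms(3) by (simp add: order_def iso_def bij_betw_same_card)
  moreover have "inj_on f P"
    using assms(3) subgroup.subset[OF P(1)] by (auto simp: iso_def bij_betw_def inj_on_subset)
  ultimately show ?thesis
    using P subgroup_img_is_subgroup by (simp add: sylow_subgroups_def card_image sylow_order_def)
qed

lemma sylow_gamma_iso:
  assumes "group G" "group H" "f \<in> iso G H"
  shows "sylow_gamma G = sylow_gamma H"
proof -
  let ?g = "inv_into (carrier G) f"
  have bij: "bij_betw f (carrier G) (carrier H)" using assms(3) by (simp add: iso_def)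
  have g: "?g \<in> iso H G" using assms(1,3) by (rule group.iso_set_sym)
  have ord: "order G = order H" using bij by (simp add: order_def bij_betw_same_card)
  have "card (sylow_subgroups G p) = card (sylow_subgroups H p)" for p
  proof (rule bij_betw_same_card, rule bij_betwI)
    show "image f \<in> sylow_subgroups G p \<rightarrow> sylow_subgroups H p"
      using sylow_subgroups_iso_image[OF assms] by blast
    show "image ?g \<in> sylow_subgroups H p \<rightarrow> sylow_subgroups G p"
      using sylow_subgroups_iso_image[OF assms(2,1) g] by blast
    show "?g ` f ` P = P" if "P \<in> sylow_subgroups G p" for P
      using that bij inv_into_image_cancel[of f "carrier G" P] subgroup.subset[of P G]
      by (simp add: sylow_subgroups_def bij_betw_def)
    show "f ` ?g ` P = P" if "P \<in> sylow_subgroups H p" for P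
      using that bij image_inv_into_cancel[of f "carrier G" "carrier H" P] subgroup.subset[of P H]
      by (simp add: sylow_subgroups_def bij_betw_def)
  qed
  then show ?thesis unfolding sylow_gamma_eq_sum sylow_order_def ord by simp
qed

text \<open>
  Moves a finite group with an arbitrary carrier type to the type over which the final assertion
  quantifies.
\<close>
lemma (in group) ex_nat_copy:
  assumes "finite (carrier G)"
  obtains H :: "nat monoid" and f where "group H" "f \<in> iso G H"
proof -
  obtain f :: "'a \<Rightarrow> nat" where "inj_on f (carrier G)"
    using finite_imp_inj_to_nat_seg[OF assms] by blast
  then show thesis using that inj_imp_image_group_is_group inj_imp_image_group_iso by blast
qed

lemma solvable_DirProd_imp_solvable:
  assumes "group G" "group H" "solvable (G \<times>\<times> H)"
  shows "solvable G"
proof -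
  interpret G: group G by fact
  interpret H: group H by fact
  interpret GH: group "G \<times>\<times> H" using assms(1,2) by (rule DirProd_group)
  interpret group_hom G "G \<times>\<times> H" "\<lambda>x. (x, \<one>\<^bsub>H\<^esub>)"
    by unfold_locales (auto simp: hom_def)
  show ?thesis using assms(3) by (intro inj_hom_imp_solvable) (auto intro: inj_onI)
qed

lemma solvable_iso:
  assumes "group G" "group H" "f \<in> iso G H" "solvable H"
  shows "solvable G"
proof -
  interpret group_hom G H f using assms by (simp add: group_hom_def group_hom_axioms_def iso_def)
  show ?thesis using assms(3,4) by (intro inj_hom_imp_solvable) (auto simp: iso_def bij_betw_def)
qed

section \<open>The Sylow numbers of the alternating group of degree 5\<close>

text \<open>
  Permutations of five points as constructor terms, so that products and commutation can be computed
  by rewriting; a term of type \<open>perm\<close> lists the images of the points.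
\<close>
datatype point = P1 | P2 | P3 | P4 | P5

datatype perm = Perm point point point point point

fun app :: "perm \<Rightarrow> point \<Rightarrow> point" where
  "app (Perm a b c d e) P1 = a"
| "app (Perm a b c d e) P2 = b"
| "app (Perm a b c d e) P3 = c"
| "app (Perm a b c d e) P4 = d"
| "app (Perm a b c d e) P5 = e"

definition comp_perm :: "perm \<Rightarrow> perm \<Rightarrow> perm" where
  "comp_perm p q = Perm (app p (app q P1)) (app p (app q P2)) (app p (app q P3))
     (app p (app q P4)) (app p (app q P5))"

definition id_perm :: perm where
  "id_perm = Perm P1 P2 P3 P4 P5"

fun nat_of_point :: "point \<Rightarrow> nat" where
  "nat_of_point P1 = 1"
| "nat_of_point P2 = 2"
| "nat_of_point P3 = 3"
| "nat_of_point P4 = 4"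
| "nat_of_point P5 = 5"

definition fun_of_perm :: "perm \<Rightarrow> nat \<Rightarrow> nat" where
  "fun_of_perm p i =
     (if i = 1 then nat_of_point (app p P1)
      else if i = 2 then nat_of_point (app p P2)
      else if i = 3 then nat_of_point (app p P3)
      else if i = 4 then nat_of_point (app p P4)
      else if i = 5 then nat_of_point (app p P5)
      else i)"

lemma fun_of_perm_nat_of_point: "fun_of_perm p (nat_of_point a) = nat_of_point (app p a)"
  by (cases a) (simp_all add: fun_of_perm_def)

lemma fun_of_perm_comp: "fun_of_perm (comp_perm p q) = fun_of_perm p \<circ> fun_of_perm q"
proof
  fix i
  show "fun_of_perm (comp_perm p q) i = (fun_of_perm p \<circ> fun_of_perm q) i"
    by (simp add: fun_of_perm_def[of q] fun_of_perm_nat_of_point)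
       (simp add: fun_of_perm_def comp_perm_def)
qed

lemma nat_of_point_eq_iff: "nat_of_point a = nat_of_point b \<longleftrightarrow> a = b"
  by (cases a; cases b; simp)

lemma inj_fun_of_perm: "inj fun_of_perm"
proof (rule injI)
  fix p q assume eq: "fun_of_perm p = fun_of_perm q"
  have app: "app p a = app q a" for a
    using fun_cong[OF eq, of "nat_of_point a"]
    by (simp add: fun_of_perm_nat_of_point nat_of_point_eq_iff)
  show "p = q"
    using app[of P1] app[of P2] app[of P3] app[of P4] app[of P5] by (cases p; cases q) simp
qed

lemma fun_of_perm_id: "fun_of_perm id_perm = id"
  by (rule ext) (simp add: fun_of_perm_def id_perm_def)

text \<open>
  Every even permutation is uniquely a product of a power of the 5-cycle \<open>(1 2 3 4 5)\<close>, a power of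
  the 3-cycle \<open>(1 2 3)\<close> and an element of the Klein four-group: the last two subgroups generate the
  stabilizer \<open>A\<^sub>4\<close> of the point \<open>5\<close>, and the powers of the 5-cycle move \<open>5\<close> to each point exactly
  once.
\<close>
definition a5_list :: "perm list" where
  "a5_list = [comp_perm x (comp_perm y z).
     x \<leftarrow> [id_perm, Perm P2 P3 P4 P5 P1, Perm P3 P4 P5 P1 P2, Perm P4 P5 P1 P2 P3, Perm P5 P1 P2 P3 P4],
     y \<leftarrow> [id_perm, Perm P2 P3 P1 P4 P5, Perm P3 P1 P2 P4 P5],
     z \<leftarrow> [id_perm, Perm P2 P1 P4 P3 P5, Perm P3 P4 P1 P2 P5, Perm P4 P3 P2 P1 P5]]"

definition commuting_perms :: "perm \<Rightarrow> perm list" where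
  "commuting_perms x = filter (\<lambda>y. comp_perm x y = comp_perm y x) a5_list"

lemma distinct_a5_list: "distinct a5_list"
  by code_simp

lemma length_a5_list: "length a5_list = 60"
  by code_simp

text \<open>
  With the identity at the head, the tail enumerates the nonidentity elements.
\<close>
lemma a5_list_Cons: "a5_list = id_perm # tl a5_list"
  by code_simp

text \<open>
  Computed by rewriting with the definitions.  The three blocks are the 3-cycles, the products of two
  disjoint transpositions and the 5-cycles.
\<close>
lemma centralizer_orders:
  "sort (map (\<lambda>x. length (commuting_perms x)) (tl a5_list)) =
   replicate 20 3 @ replicate 15 4 @ replicate 24 5"
  by code_simp

lemma fun_of_three_cycle_in_A5:
  assumes "fun_of_perm p = cycle_of_list cs" "distinct cs" "length cs = 3" "set cs \<subseteq> {1..5}"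
  shows "fun_of_perm p \<in> carrier A5"
  using three_cycles_incl[of 5] assms by auto

lemma fun_of_perm_comp_in_A5:
  assumes "fun_of_perm p \<in> carrier A5" "fun_of_perm q \<in> carrier A5"
  shows "fun_of_perm (comp_perm p q) \<in> carrier A5"
  using monoid.m_closed[OF group.is_monoid[OF alt_group_is_group] assms]
  by (simp add: fun_of_perm_comp alt_group_mult)

text \<open>
  Evenness is inherited from 3-cycles: \<open>(1 2 3 4 5) = (1 2 3)(3 4 5)\<close> and
  \<open>(1 2)(3 4) = (1 2 3)(2 3 4)\<close>, and conjugating the latter by \<open>(1 2 3)\<close> gives another element of the
  Klein four-group.
\<close>
lemma fun_of_perm_in_A5:
  assumes "x \<in> set a5_list"
  shows "fun_of_perm x \<in> carrier A5"
proof -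
  let ?A = "\<lambda>p. fun_of_perm p \<in> carrier A5"
  note c = fun_of_perm_comp_in_A5
  have 1: "?A id_perm"
    using monoid.one_closed[OF group.is_monoid[OF alt_group_is_group], of 5]
    by (simp add: fun_of_perm_id alt_group_one)
  have t1: "?A (Perm P2 P3 P1 P4 P5)"
    by (rule fun_of_three_cycle_in_A5[of _ "[1, 2, 3]"])
       (auto simp: fun_eq_iff fun_of_perm_def transpose_def)
  have t2: "?A (Perm P1 P3 P4 P2 P5)"
    by (rule fun_of_three_cycle_in_A5[of _ "[2, 3, 4]"])
       (auto simp: fun_eq_iff fun_of_perm_def transpose_def)
  have t3: "?A (Perm P1 P2 P4 P5 P3)"
    by (rule fun_of_three_cycle_in_A5[of _ "[3, 4, 5]"])
       (auto simp: fun_eq_iff fun_of_perm_def transpose_def)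
  have t4: "?A (Perm P3 P1 P2 P4 P5)" 
    using c[OF t1 t1] by (simp add: comp_perm_def)
  have v1: "?A (Perm P2 P1 P4 P3 P5)"
    using c[OF t1 t2] by (simp add: comp_perm_def)
  have v2: "?A (Perm P4 P3 P2 P1 P5)"
    using c[OF c[OF t1 v1] t4] by (simp add: comp_perm_def)
  have v3: "?A (Perm P3 P4 P1 P2 P5)"
    using c[OF v1 v2] by (simp add: comp_perm_def)
  have f1: "?A (Perm P2 P3 P4 P5 P1)"
    using c[OF t1 t3] by (simp add: comp_perm_def)
  have f2: "?A (Perm P3 P4 P5 P1 P2)"
    using c[OF f1 f1] by (simp add: comp_perm_def)
  have f3: "?A (Perm P4 P5 P1 P2 P3)"
    using c[OF f2 f1] by (simp add: comp_perm_def)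
  have f4: "?A (Perm P5 P1 P2 P3 P4)"
    using c[OF f3 f1] by (simp add: comp_perm_def)
  show ?thesis
    using assms unfolding a5_list_def
    by (auto intro!: c 1 t1 t4 v1 v2 v3 f1 f2 f3 f4)
qed

lemma order_A5: "order A5 = 60"
  using alt_group_card_carrier[of 5] by (simp add: order_def fact_numeral)

lemma finite_A5: "finite (carrier A5)"
  using order_A5 card.infinite by (fastforce simp: order_def)

text \<open>
  The listed permutations are distinct and even, and there are as many of them as the order of
  \<open>A\<^sub>5\<close>; so none is missing.
\<close>
lemma carrier_A5: "carrier A5 = fun_of_perm ` set a5_list"
proof (rule card_subset_eq[symmetric])
  show "finite (carrier A5)" by (rule finite_A5)
  show "fun_of_perm ` set a5_list \<subseteq> carrier A5" using fun_of_perm_in_A5 by blast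
  have "card (fun_of_perm ` set a5_list) = card (set a5_list)"
    by (intro card_image inj_on_subset[OF inj_fun_of_perm]) simp
  then show "card (fun_of_perm ` set a5_list) = card (carrier A5)"
    using order_A5 distinct_card[OF distinct_a5_list] length_a5_list by (simp add: order_def)
qed

lemma carrier_A5_minus_one: "carrier A5 - {\<one>\<^bsub>A5\<^esub>} = fun_of_perm ` set (tl a5_list)"
proof -
  have "set a5_list = insert id_perm (set (tl a5_list))" "id_perm \<notin> set (tl a5_list)"
    using a5_list_Cons distinct_a5_list by (metis list.simps(15), metis distinct.simps(2))
  then show ?thesis
    using inj_fun_of_perm
    by (auto simp: carrier_A5 alt_group_one simp flip: fun_of_perm_id dest: injD)
qed

lemma card_centralizer_A5:
  assumes "x \<in> set a5_list"
  shows "card (centralizer A5 (fun_of_perm x)) = length (commuting_perms x)"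
proof -
  have "centralizer A5 (fun_of_perm x) = fun_of_perm ` set (commuting_perms x)"
    by (auto simp: centralizer_def commuting_perms_def carrier_A5 alt_group_mult inj_eq[OF inj_fun_of_perm]
        simp flip: fun_of_perm_comp)
  moreover have "distinct (commuting_perms x)"
    by (simp add: commuting_perms_def distinct_a5_list)
  ultimately show ?thesis
    by (simp add: card_image inj_on_subset[OF inj_fun_of_perm] distinct_card)
qed

lemma length_commuting_perms:
  assumes "x \<in> set (tl a5_list)"
  shows "length (commuting_perms x) \<in> {3, 4, 5}"
proof -
  have "length (commuting_perms x) \<in> set (sort (map (\<lambda>x. length (commuting_perms x)) (tl a5_list)))"
    using assms by simp
  then show ?thesis unfolding centralizer_orders by auto
qed

lemma card_centralizer_order_eq_A5:
  "card {x \<in> carrier A5 - {\<one>\<^bsub>A5\<^esub>}. card (centralizer A5 x) = s} =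
   count_list (replicate 20 3 @ replicate 15 4 @ replicate 24 5) s"
proof -
  let ?f = "\<lambda>x. length (commuting_perms x)" and ?L = "tl a5_list"
  have "set ?L \<subseteq> set a5_list" by (metis a5_list_Cons set_subset_Cons)
  then have "{x \<in> carrier A5 - {\<one>\<^bsub>A5\<^esub>}. card (centralizer A5 x) = s} =
    fun_of_perm ` set (filter (\<lambda>x. ?f x = s) ?L)"
    unfolding carrier_A5_minus_one using card_centralizer_A5 by (auto simp: subset_iff)
  also have "card \<dots> = card (set (filter (\<lambda>x. ?f x = s) ?L))"
    by (intro card_image inj_on_subset[OF inj_fun_of_perm]) simp
  also have "\<dots> = length (filter (\<lambda>x. ?f x = s) ?L)"
    by (intro distinct_card distinct_filter distinct_tl distinct_a5_list)
  also have "\<dots> = count_list (map ?f ?L) s"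
    by (induction ?L) (simp_all add: count_list_eq_length_filter filter_map comp_def eq_commute)
  also have "\<dots> = count_list (sort (map ?f ?L)) s"
    by (metis count_mset mset_sort)
  finally show ?thesis by (simp only: centralizer_orders)
qed

lemma card_subgroups_A5:
  assumes "s \<in> {3, 4, 5}"
  shows "card {P. subgroup P A5 \<and> card P = s} * (s - 1) =
    count_list (replicate 20 3 @ replicate 15 4 @ replicate 24 5) s"
proof -
  interpret group A5 by (rule alt_group_is_group)
  have "x \<otimes>\<^bsub>A5\<^esub> y = y \<otimes>\<^bsub>A5\<^esub> x" if "subgroup P A5" "card P = s" "x \<in> P" "y \<in> P" for P x y
    using assms that finite_subset[OF subgroup.subset[OF that(1)] finite_A5]
    by (intro subgroup_card_le_5_comm[of P]) auto
  moreover have "card (centralizer A5 x) = s"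
    if "x \<in> carrier A5 - {\<one>\<^bsub>A5\<^esub>}" "s dvd card (centralizer A5 x)" for x
  proof -
    have "card (centralizer A5 x) \<in> {3, 4, 5}"
      using that(1) card_centralizer_A5 length_commuting_perms unfolding carrier_A5_minus_one
      by (metis (no_types, lifting) a5_list_Cons imageE list.set_intros(2))
    then show ?thesis using that(2) assms by auto
  qed
  ultimately show ?thesis
    using card_subgroups_eq_centralizers[OF finite_A5, of s] card_centralizer_order_eq_A5 by simp
qed

lemma multiplicity_60:
  "multiplicity 2 (60 :: nat) = 2" "multiplicity 3 (60 :: nat) = 1" "multiplicity 5 (60 :: nat) = 1"
  by (simp_all add: multiplicity_eqI)

lemma sylow_order_A5:
  "sylow_order A5 2 = 4" "sylow_order A5 3 = 3" "sylow_order A5 5 = 5"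
  by (simp_all add: sylow_order_def order_A5 multiplicity_60)

lemma card_sylow_subgroups_A5:
  "card (sylow_subgroups A5 2) = 5"
  "card (sylow_subgroups A5 3) = 10"
  "card (sylow_subgroups A5 5) = 6"
  using card_subgroups_A5[of 4] card_subgroups_A5[of 3] card_subgroups_A5[of 5]
  by (simp_all add: sylow_subgroups_def sylow_order_A5 count_list_eq_length_filter)

section \<open>The counterexample\<close>

lemma order_G0: "order G0 = 60 * (2 * (7 * (11 * (13 * (17 * (19 * (29 * (71 * 83))))))))"
  by (simp only: G0_def order_DirProd order_A5 order_C zero_less_numeral)

lemma prime_numerals:
  "prime (2::nat)" "prime (3::nat)" "prime (5::nat)" "prime (7::nat)" "prime (11::nat)" "prime (13::nat)"
  "prime (17::nat)" "prime (19::nat)" "prime (29::nat)" "prime (71::nat)" "prime (83::nat)"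
  by simp_all

lemma prime_factors_order_G0:
  "prime_factors (order G0) = {2, 3, 5, 7, 11, 13, 17, 19, 29, 71, 83}"
proof -
  have nonzero: "numeral n \<noteq> (0 :: nat)" for n by simp
  have "order G0 = 2 * (2 * (3 * 5)) * (2 * (7 * (11 * (13 * (17 * (19 * (29 * (71 * 83))))))))"
    unfolding order_G0 by simp
  then show ?thesis
    by (simp only: prime_factors_product prime_prime_factors prime_numerals
        mult_eq_0_iff nonzero simp_thms) auto
qed

lemma card_sylow_subgroups_G0:
  assumes "prime p"
  shows "card (sylow_subgroups G0 p) = card (sylow_subgroups A5 p)"
  unfolding G0_def
  by (simp add: card_sylow_subgroups_DirProd card_sylow_subgroups_C_prime assms prime_numerals
      DirProd_group alt_group_is_group finite_A5 finite_carrier_C)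

lemma sylow_order_G0:
  assumes "prime p"
  shows "sylow_order G0 p =
    sylow_order A5 p * (if p \<in> {2, 7, 11, 13, 17, 19, 29, 71, 83} then p else 1)"
  unfolding G0_def
  by (simp add: sylow_order_DirProd sylow_order_C_prime order_DirProd order_A5 order_C assms prime_numerals)

lemma sylow_gamma_G0: "sylow_gamma G0 = 9 / 2"
proof -
  have "\<not> p dvd order A5" if "p \<in> {7, 11, 13, 17, 19, 29, 71, 83}" for p
    using that by (auto simp: order_A5)
  then have "card (sylow_subgroups A5 p) = 1" "sylow_order A5 p = 1"
    if "p \<in> {7, 11, 13, 17, 19, 29, 71, 83}" for p
    using that group.card_sylow_subgroups_not_dvd[OF alt_group_is_group] sylow_order_not_dvd
    by blast+
  \<comment> \<open>The sum is \<open>5/9 + 10/4 + 6/6\<close> plus the eight unit fractions, whose total is \<open>4/9\<close>.\<close>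
  then show ?thesis
    unfolding sylow_gamma_eq_sum prime_factors_order_G0
    by (simp add: card_sylow_subgroups_G0 sylow_order_G0 prime_numerals
        card_sylow_subgroups_A5 sylow_order_A5)
qed

lemma not_solvable_G0: "\<not> solvable G0"
proof
  assume "solvable G0"
  then have "solvable A5"
    unfolding G0_def
    by (rule solvable_DirProd_imp_solvable[rotated 2])
       (intro DirProd_group group_integer_mod_group alt_group_is_group)+
  then show False using alt_group_is_unsolvable[of 5] by simp
qed

lemma not_iso_G0_A5: "\<not> G0 \<cong> A5"
  using iso_same_card[of G0 A5] order_G0 order_A5 by (auto simp: order_def)

theorem theorem1p1:
  shows "m0 = 55254930731 \<and>
         \<not> solvable G0 \<and>
         \<not> G0 \<cong> A5 \<and>
         sylow_gamma G0 = 9 / 2 \<and>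
         \<not> (\<forall>G :: nat monoid.
               group G \<and> finite (carrier G) \<and> \<not> solvable G \<longrightarrow>
               (sylow_gamma G = 9 / 2 \<longleftrightarrow> G \<cong> A5))"
proof (intro conjI)
  show "m0 = 55254930731" by (simp add: m0_def)
  show "\<not> solvable G0" by (rule not_solvable_G0)
  show "\<not> G0 \<cong> A5" by (rule not_iso_G0_A5)
  show "sylow_gamma G0 = 9 / 2" by (rule sylow_gamma_G0)
  obtain H :: "nat monoid" and f where H: "group H" and f: "f \<in> iso G0 H"
    using group.ex_nat_copy[OF group_G0 finite_G0] .
  have "finite (carrier H)"
    using f finite_G0 by (auto simp: iso_def dest: bij_betw_finite)
  moreover have "\<not> solvable H"
    using solvable_iso[OF group_G0 H f] not_solvable_G0 by blast
  moreover have "sylow_gamma H = 9 / 2"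
    using sylow_gamma_iso[OF group_G0 H f] sylow_gamma_G0 by simp
  moreover have "\<not> H \<cong> A5"
    using iso_trans[OF is_isoI[OF f]] not_iso_G0_A5 by blast
  ultimately show "\<not> (\<forall>G :: nat monoid.
      group G \<and> finite (carrier G) \<and> \<not> solvable G \<longrightarrow>
      (sylow_gamma G = 9 / 2 \<longleftrightarrow> G \<cong> A5))"
    using H by blast
qed

end
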